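(* Let $G$ be a connected graph and let $\mathcal{I}(G)$ denote the set of all independent sets of $G$ (including the empty set). Then $$\alpha(M(G)) = \max_{S\in \mathcal{I}(G)} \{ 2|S| + |V(G)\setminus N[S]|\},$$ where $M(G)$ is the Mycielskian of $G$.
   Context: All graphs are finite and simple. $\alpha(H)$ denotes the independence number of a graph $H$. For $S\subseteq V(G)$, $N[S]$ is the closed neighborhood of $S$, i.e. $S$ together with all vertices adjacent to some vertex of $S$. The Mycielskian $M(G)$ of a graph $G$ is the graph with vertex set $V(G)\cup V'\cup\{w\}$, where $V'=\{x' : x\in V(G)\}$ is a set of new vertices (one copy per vertex of $G$) and $w$ is a further new vertex, and with edge set $E(G)\cup\{xy' : xy\in E(G)\}\cup\{wx' : x'\in V'\}$. *)

theory Defs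
  imports "Graph_Theory.Graph_Theory"
begin

text \<open>
  Finite simple graphs are modelled by \<^locale>\<open>pair_graph\<close>: finite, loop-free digraphs with a
  symmetric set of arcs, an edge \<open>xy\<close> being the pair of arcs \<open>(x, y)\<close>, \<open>(y, x)\<close>.
  Connectedness is \<^const>\<open>Digraph_Component.connected\<close>, which excludes the graph without vertices.
\<close>

definition independent_sets :: "'a pair_pre_digraph \<Rightarrow> 'a set set" where
  "independent_sets G = {S. S \<subseteq> pverts G \<and> (\<forall>u\<in>S. \<forall>v\<in>S. (u, v) \<notin> parcs G)}"

definition independence_number :: "'a pair_pre_digraph \<Rightarrow> nat" where
  "independence_number G = Max (card ` independent_sets G)"

definition closed_neighborhood :: "'a pair_pre_digraph \<Rightarrow> 'a set \<Rightarrow> 'a set" where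
  "closed_neighborhood G S = S \<union> {v \<in> pverts G. \<exists>u\<in>S. (u, v) \<in> parcs G}"

datatype 'a mycielski_vertex = Orig 'a | Copy 'a | Apex

text \<open>\<open>E\<close> contains every edge in at least one orientation; adding its converse makes the
  arc set symmetric.\<close>

definition mycielskian :: "'a pair_pre_digraph \<Rightarrow> 'a mycielski_vertex pair_pre_digraph" where
  "mycielskian G =
    (let E = {(Orig x, Orig y) | x y. (x, y) \<in> parcs G}
           \<union> {(Orig x, Copy y) | x y. (x, y) \<in> parcs G}
           \<union> {(Apex, Copy x) | x. x \<in> pverts G}
     in \<lparr> pverts = Orig ` pverts G \<union> Copy ` pverts G \<union> {Apex}, parcs = E \<union> E\<inverse> \<rparr>)"

lemma finite_independent_sets: "pair_graph G \<Longrightarrow> finite (independent_sets G)"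
  by (rule finite_subset[of _ "Pow (pverts G)"])
    (auto simp: independent_sets_def dest: pair_graph.axioms pair_digraph.axioms
      pair_fin_digraph.pair_finite_verts)

lemma empty_in_independent_sets: "{} \<in> independent_sets G"
  by (simp add: independent_sets_def)

lemma pair_graph_mycielskian:
  assumes "pair_graph G"
  shows "pair_graph (mycielskian G)"
proof -
  interpret pair_graph G by fact
  have ends: "x \<in> pverts G \<and> y \<in> pverts G" if "(x, y) \<in> parcs G" for x y
    using arc_fst_in_verts[OF that] arc_snd_in_verts[OF that] by simp
  have V: "finite (pverts (mycielskian G))"
    by (simp add: mycielskian_def Let_def pair_finite_verts)
  have sub: "parcs (mycielskian G) \<subseteq> pverts (mycielskian G) \<times> pverts (mycielskian G)"
    by (auto simp: mycielskian_def Let_def dest: ends)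
  show ?thesis
  proof
    show "finite (parcs (mycielskian G))"
      using finite_subset[OF sub] V by blast
    show "symmetric (with_proj (mycielskian G))"
      by (auto simp: symmetric_def mycielskian_def Let_def sym_def)
    show "fst e \<noteq> snd e" if "e \<in> parcs (mycielskian G)" for e
      using that pair_no_loops by (fastforce simp: mycielskian_def Let_def)
  qed (use V sub in auto)
qed

end

theory Submission
  imports Defs
begin

text \<open>
  An independent set of the Mycielskian that avoids the apex consists of an independent set \<open>S\<close>
  of originals and a set of copies of vertices without a neighbour in \<open>S\<close>, that is, of vertices in
  \<open>S \<union> (V - N[S])\<close>. Taking all those copies gives size \<open>2|S| + |V - N[S]|\<close>. An independent set that
  contains the apex contains no copy, so it has size \<open>|S| + 1\<close>, which is at most \<open>2|S|\<close> if
  \<open>S \<noteq> {}\<close>, and at most \<open>|V|\<close> if \<open>S = {}\<close>, as \<open>V\<close> is nonempty.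
\<close>

text \<open>The arc set of \<open>mycielskian G\<close> is \<open>E \<union> E\<inverse>\<close>, so
  an arc may come from either orientation of an edge of \<open>G\<close>. Symmetry of
  \<open>parcs G\<close> merges the two cases into one condition.\<close>

lemma arc_mycielskian_iff:
  assumes "pair_graph G"
  shows "(Orig x, Orig y) \<in> parcs (mycielskian G) \<longleftrightarrow> (x, y) \<in> parcs G"
    and "(Orig x, Copy y) \<in> parcs (mycielskian G) \<longleftrightarrow> (x, y) \<in> parcs G"
    and "(Copy x, Orig y) \<in> parcs (mycielskian G) \<longleftrightarrow> (x, y) \<in> parcs G"
    and "(Copy x, Copy y) \<notin> parcs (mycielskian G)"
    and "(Apex, Copy y) \<in> parcs (mycielskian G) \<longleftrightarrow> y \<in> pverts G"
proof -
  interpret pair_graph G by fact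
  have "(x, y) \<in> parcs G \<longleftrightarrow> (y, x) \<in> parcs G" for x y
    by (blast intro: arcs_symmetric)
  then show "(Orig x, Orig y) \<in> parcs (mycielskian G) \<longleftrightarrow> (x, y) \<in> parcs G"
    and "(Orig x, Copy y) \<in> parcs (mycielskian G) \<longleftrightarrow> (x, y) \<in> parcs G"
    and "(Copy x, Orig y) \<in> parcs (mycielskian G) \<longleftrightarrow> (x, y) \<in> parcs G"
    and "(Copy x, Copy y) \<notin> parcs (mycielskian G)"
    and "(Apex, Copy y) \<in> parcs (mycielskian G) \<longleftrightarrow> y \<in> pverts G"
    by (auto simp: mycielskian_def Let_def)
qed

lemma pverts_mycielskian:
  "pverts (mycielskian G) = Orig ` pverts G \<union> Copy ` pverts G \<union> {Apex}"
  by (simp add: mycielskian_def Let_def)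

lemma card_Orig_Un_Copy:
  assumes "finite S" "finite T"
  shows "card (Orig ` S \<union> Copy ` T) = card S + card T"
  using assms by (subst card_Un_disjoint) (auto simp: card_image inj_on_def)

lemma card_Un_diff_closed_neighborhood:
  assumes "finite (pverts G)" "S \<subseteq> pverts G"
  shows "card (S \<union> (pverts G - closed_neighborhood G S)) =
    card S + card (pverts G - closed_neighborhood G S)"
  using assms by (intro card_Un_disjoint) (auto simp: closed_neighborhood_def dest: finite_subset)

text \<open>The neighbours of \<open>Copy x\<close> among the originals are the
  \<open>Orig y\<close> with \<open>y\<close> adjacent to \<open>x\<close>. None of them has
  \<open>y\<close> in \<open>S\<close>: for \<open>x\<close> in \<open>S\<close> by independence,
  for \<open>x\<close> outside N[S] by the choice of \<open>x\<close>.\<close>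

lemma lift_in_independent_sets_mycielskian:
  assumes "pair_graph G" "S \<in> independent_sets G"
  shows "Orig ` S \<union> Copy ` (S \<union> (pverts G - closed_neighborhood G S))
    \<in> independent_sets (mycielskian G)"
proof -
  interpret pair_graph G by fact
  show ?thesis
    using assms(2)
    \<comment> \<open>\<open>closed_neighborhood\<close> looks only at arcs leaving
      \<open>S\<close>; an arc from a copy to an original enters \<open>S\<close> and must be
      reversed.\<close>
    by (auto simp: independent_sets_def pverts_mycielskian arc_mycielskian_iff[OF assms(1)]
        closed_neighborhood_def)
      (blast intro: arcs_symmetric)
qed

text \<open>Nonemptiness matters: over the empty graph, \<open>{Apex}\<close> is independent of size
  1, while the bound is 0.\<close>

lemma card_independent_set_mycielskian_le:
  assumes "pair_graph G" "pverts G \<noteq> {}" "I \<in> independent_sets (mycielskian G)"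
  shows "\<exists>S \<in> independent_sets G.
    card I \<le> 2 * card S + card (pverts G - closed_neighborhood G S)"
proof -
  interpret pair_graph G by fact
  note arc = arc_mycielskian_iff[OF assms(1)]
  define S where "S = {x. Orig x \<in> I}"
  define T where "T = {x. Copy x \<in> I}"
  have I: "I \<subseteq> pverts (mycielskian G)" "\<And>u v. u \<in> I \<Longrightarrow> v \<in> I \<Longrightarrow> (u, v) \<notin> parcs (mycielskian G)"
    using assms(3) by (auto simp: independent_sets_def)
  have SV: "S \<subseteq> pverts G" and TV: "T \<subseteq> pverts G"
    using I(1) by (auto simp: S_def T_def pverts_mycielskian)
  then have fin: "finite S" "finite T"
    using pair_finite_verts finite_subset by blast+
  have S: "S \<in> independent_sets G"
    using SV I(2) arc(1) by (fastforce simp: independent_sets_def S_def)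
  show ?thesis
  proof (cases "Apex \<in> I")
    case False
    have "I = Orig ` S \<union> Copy ` T"
      using I(1) False by (auto simp: S_def T_def pverts_mycielskian)
    then have "card I = card S + card T"
      using fin by (simp add: card_Orig_Un_Copy)
    \<comment> \<open>A vertex of \<open>T\<close> in N[S] but not in \<open>S\<close> has a
      neighbour \<open>u\<close> in \<open>S\<close>, and then its copy is adjacent to
      \<open>Orig u\<close>, also in \<open>I\<close>.\<close>
    moreover have "T \<subseteq> S \<union> (pverts G - closed_neighborhood G S)"
      using TV I(2) arc(2) by (fastforce simp: closed_neighborhood_def S_def T_def)
    then have "card T \<le> card (S \<union> (pverts G - closed_neighborhood G S))"
      using fin pair_finite_verts by (intro card_mono) auto
    ultimately have "card I \<le> 2 * card S + card (pverts G - closed_neighborhood G S)"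
      using card_Un_diff_closed_neighborhood[OF pair_finite_verts SV] by simp
    with S show ?thesis by blast
  next
    case True
    then have "T = {}"
      using TV I(2) arc(5) by (fastforce simp: T_def)
    then have "I = insert Apex (Orig ` S)"
      using I(1) True by (auto simp: S_def T_def pverts_mycielskian)
    then have cI: "card I = Suc (card S)"
      using fin by (auto simp: card_image inj_on_def card_insert_if)
    show ?thesis
    proof (cases "S = {}")
      case True
      \<comment> \<open>Here \<open>I\<close> is \<open>{Apex}\<close>. Since N[{}] is empty, the
        bound for \<open>S\<close> is the size of the whole vertex set.\<close>
      then have "card I \<le> card (pverts G)"
        using cI assms(2) pair_finite_verts by (simp add: Suc_le_eq card_gt_0_iff)
      then show ?thesis
        using S True by (intro bexI[of _ S]) (auto simp: closed_neighborhood_def)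
    next
      case False
      then have "card S > 0" using fin by (simp add: card_gt_0_iff)
      then show ?thesis using cI S by (intro bexI[of _ S]) auto
    qed
  qed
qed

theorem theorem2p1:
  fixes G :: "'a pair_pre_digraph"
  assumes "pair_graph G"
    and "Digraph_Component.connected (with_proj G)"
  shows "independence_number (mycielskian G) =
    (MAX S \<in> independent_sets G. 2 * card S + card (pverts G - closed_neighborhood G S))"
proof -
  interpret pair_graph G by fact
  let ?f = "\<lambda>S. 2 * card S + card (pverts G - closed_neighborhood G S)"
  have ne: "pverts G \<noteq> {}"
    \<comment> \<open>\<open>strongly_connected\<close> includes that there is a vertex.\<close>
    using assms(2) by (auto simp: connected_def strongly_connected_def)
  note fin = finite_independent_sets[OF assms(1)]
  note finM = finite_independent_sets[OF pair_graph_mycielskian[OF assms(1)]]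
  show ?thesis
    unfolding independence_number_def
  proof (rule antisym)
    show "Max (card ` independent_sets (mycielskian G)) \<le> Max (?f ` independent_sets G)"
    proof (rule Max.boundedI)
      fix n assume "n \<in> card ` independent_sets (mycielskian G)"
      then obtain S where "S \<in> independent_sets G" "n \<le> ?f S"
        using card_independent_set_mycielskian_le[OF assms(1) ne] by blast
      then show "n \<le> Max (?f ` independent_sets G)"
        using fin by (auto intro: order_trans[OF _ Max_ge])
    \<comment> \<open>\<open>Max\<close> is meaningful only on finite nonempty sets; the empty
      independent set provides an element.\<close>
    qed (use finM empty_in_independent_sets in auto)
    \<comment> \<open>The lift of \<open>S\<close> has size exactly \<open>?f S\<close>, since
      \<open>S\<close> is counted once as originals and once as copies.\<close>
    have "?f S \<le> Max (card ` independent_sets (mycielskian G))" if S: "S \<in> independent_sets G" for S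
    proof -
      let ?T = "S \<union> (pverts G - closed_neighborhood G S)"
      have SV: "S \<subseteq> pverts G" using S by (simp add: independent_sets_def)
      then have "finite S" using pair_finite_verts finite_subset by blast
      then have "?f S = card (Orig ` S \<union> Copy ` ?T)"
        using card_Un_diff_closed_neighborhood[OF pair_finite_verts SV] pair_finite_verts
        by (subst card_Orig_Un_Copy) auto
      then show ?thesis
        using lift_in_independent_sets_mycielskian[OF assms(1) S] finM by simp
    qed
    then show "Max (?f ` independent_sets G) \<le> Max (card ` independent_sets (mycielskian G))"
      using fin empty_in_independent_sets by (subst Max_le_iff) auto
  qed
qed

end
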